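(* Let $\mathbb{T}$ be a structure over a vocabulary $\mathcal{V}$ and $\Sigma$ a finite set. The class of $\mathbb{T}$-PALs (over alphabet $\Sigma\times\mathbb{T}$) is closed under intersection and complement (relative to $(\Sigma\times\mathbb{T})^*$), and so is the class of monadic $\mathbb{T}$-PALs. Every $\mathbb{T}$-PAL is closed under the equivalence relation $\simeq$ on words.
   Context: For a structure and a set $V$ of elements, $N(V)$ is the substructure generated by $V$; $N(\vec a)$ that of the entries of tuple $\vec a$. For tuples $\vec a,\vec b\in\mathbb{T}^n$, $\vec a\simeq\vec b$ if there is an isomorphism $\beta:N(\vec a)\to N(\vec b)$ with $\beta(\vec a)=\vec b$. On words: $\langle\sigma_1:v_1\rangle\cdots\langle\sigma_n:v_n\rangle\simeq\langle\sigma'_1:v'_1\rangle\cdots\langle\sigma'_{n'}:v'_{n'}\rangle$ iff $(\sigma_1,\dots,\sigma_n)=(\sigma'_1,\dots,\sigma'_{n'})$ and $(v_1,\dots,v_n)\simeq(v'_1,\dots,v'_n)$. $\mathcal{V}[\mathbb{T}]$ is $\mathcal{V}$ expanded by a constant for each element of $\mathbb{T}$. A $\mathbb{T}$-predicate automaton (PA) is $A=(\mathcal{Q},\Sigma\times\mathbb{T},\delta,\varphi_{\mathsf{start}},F)$ where $\mathcal{Q}$ is a finite relational vocabulary disjoint from $\mathcal{V}[\mathbb{T}]$; $\mathcal{F}_+(\mathcal{V},\mathcal{Q})$ denotes the quantifier-free $(\mathcal{V}\cup\mathcal{Q})$-formulas in which every atom $q(t_1,\dots,t_{\mathsf{ar}(q)})$,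 $q\in\mathcal{Q}$, occurs positively; $\varphi_{\mathsf{start}}\in\mathcal{F}_+(\mathcal{V},\mathcal{Q})$ has no free variables; $F\subseteq\mathcal{Q}$; and $\delta:\mathcal{Q}\times\Sigma\to\mathcal{F}_+(\mathcal{V},\mathcal{Q})$ with the free variables of $\delta(q,\sigma)$ among $v_0,\dots,v_{\mathsf{ar}(q)}$. The arity of $A$ is the maximum arity of symbols in $\mathcal{Q}$; $A$ is monadic if its arity is $1$. States are ground atoms $q(a_1,\dots,a_{\mathsf{ar}(q)})$ with $a_j\in\mathbb{T}$. The semantic transition $\hat\delta(q(a_1,\dots,a_{\mathsf{ar}(q)}),\langle\sigma:a_0\rangle)$ is $\delta(q,\sigma)$ with $v_j\mapsto a_j$, where $\mathcal{V}$-atoms are evaluated in $\mathbb{T}$, yielding a negation-free Boolean combination of states. A configuration is a finite set of states (read as their conjunction); it is initial if it is a cube of the disjunctive normal form of $\varphi_{\mathsf{start}}$, and accepting if every state in it has predicate symbol in $F$. $\mathcal{C}\xrightarrow{\sigma:a}\mathcal{C}'$ iff $\mathcal{C}'$ is a cube of the DNF of $\bigwedge_{t\in\mathcal{C}}\hat\delta(t,\langle\sigma:a\rangle)$. $A$ accepts $\langle\sigma_1:a_1\rangle\cdots\langle\sigma_n:a_n\rangle$ if there are configurations $\mathcal{C}_0,\dots,\mathcal{C}_n$ with $\mathcal{C}_n$ initial, $\mathcal{C}_0$ accepting and $\mathcal{C}_r\xrightarrow{\sigma_r:a_r}\mathcal{C}_{r-1}$ for $r=n,\dots,1$. $\mathcal{L}(A)$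 is the set of accepted words; a ($monadic$) $\mathbb{T}$-PAL is the language of some (monadic) $\mathbb{T}$-PA. *)

theory Defs
  imports Main
begin

section \<open>Structures\<close>

text \<open>Constants are nullary function symbols.\<close>

record ('f, 'r) vocab =
  funs :: "'f set"
  fun_ar :: "'f \<Rightarrow> nat"
  rels :: "'r set"
  rel_ar :: "'r \<Rightarrow> nat"

record ('f, 'r, 'a) struct =
  univ :: "'a set"
  fun_int :: "'f \<Rightarrow> 'a list \<Rightarrow> 'a"
  rel_int :: "'r \<Rightarrow> 'a list \<Rightarrow> bool"

definition closed_in :: "('f, 'r) vocab \<Rightarrow> ('f, 'r, 'a) struct \<Rightarrow> 'a set \<Rightarrow> bool" where
  "closed_in V T D \<longleftrightarrow>
     (\<forall>f\<in>funs V. \<forall>xs\<in>lists D. length xs = fun_ar V f \<longrightarrow> fun_int T f xs \<in> D)"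

text \<open>Empty structures are admitted: the substructure generated by the empty set is empty
  if there are no constants.\<close>

definition is_struct :: "('f, 'r) vocab \<Rightarrow> ('f, 'r, 'a) struct \<Rightarrow> bool" where
  "is_struct V T \<longleftrightarrow> closed_in V T (univ T)"

definition generated :: "('f, 'r) vocab \<Rightarrow> ('f, 'r, 'a) struct \<Rightarrow> 'a set \<Rightarrow> ('f, 'r, 'a) struct" where
  "generated V T X = T\<lparr>univ := \<Inter>{D. X \<subseteq> D \<and> D \<subseteq> univ T \<and> closed_in V T D}\<rparr>"

definition is_iso ::
  "('f, 'r) vocab \<Rightarrow> ('f, 'r, 'a) struct \<Rightarrow> ('f, 'r, 'b) struct \<Rightarrow> ('a \<Rightarrow> 'b) \<Rightarrow> bool" where
  "is_iso V S S' \<beta> \<longleftrightarrow>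
     bij_betw \<beta> (univ S) (univ S') \<and>
     (\<forall>f\<in>funs V. \<forall>xs\<in>lists (univ S). length xs = fun_ar V f \<longrightarrow>
        \<beta> (fun_int S f xs) = fun_int S' f (map \<beta> xs)) \<and>
     (\<forall>R\<in>rels V. \<forall>xs\<in>lists (univ S). length xs = rel_ar V R \<longrightarrow>
        (rel_int S R xs \<longleftrightarrow> rel_int S' R (map \<beta> xs)))"

definition tuple_equiv :: "('f, 'r) vocab \<Rightarrow> ('f, 'r, 'a) struct \<Rightarrow> 'a list \<Rightarrow> 'a list \<Rightarrow> bool" where
  "tuple_equiv V T as bs \<longleftrightarrow>
     (\<exists>\<beta>. is_iso V (generated V T (set as)) (generated V T (set bs)) \<beta> \<and> map \<beta> as = bs)"

definition words :: "'s set \<Rightarrow> ('f, 'r, 'a) struct \<Rightarrow> ('s \<times> 'a) list set" where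
  "words \<Sigma> T = lists (\<Sigma> \<times> univ T)"

definition word_equiv ::
  "('f, 'r) vocab \<Rightarrow> ('f, 'r, 'a) struct \<Rightarrow> ('s \<times> 'a) list \<Rightarrow> ('s \<times> 'a) list \<Rightarrow> bool" where
  "word_equiv V T w w' \<longleftrightarrow>
     map fst w = map fst w' \<and> tuple_equiv V T (map snd w) (map snd w')"

section \<open>Quantifier-free formulas\<close>

datatype 'f tm = Var nat | Fun 'f "'f tm list"

fun tm_vars :: "'f tm \<Rightarrow> nat set" where
  "tm_vars (Var i) = {i}"
| "tm_vars (Fun f ts) = (\<Union>t\<in>set ts. tm_vars t)"

fun wf_tm :: "('f, 'r) vocab \<Rightarrow> 'f tm \<Rightarrow> bool" where
  "wf_tm V (Var i) \<longleftrightarrow> True"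
| "wf_tm V (Fun f ts) \<longleftrightarrow> f \<in> funs V \<and> length ts = fun_ar V f \<and> (\<forall>t\<in>set ts. wf_tm V t)"

fun tm_val :: "('f, 'r, 'a) struct \<Rightarrow> (nat \<Rightarrow> 'a) \<Rightarrow> 'f tm \<Rightarrow> 'a" where
  "tm_val T e (Var i) = e i"
| "tm_val T e (Fun f ts) = fun_int T f (map (tm_val T e) ts)"

text \<open>Atoms over the vocabulary (\<open>Eq\<close>, \<open>Rel\<close>) and atoms over the automaton predicates (\<open>Pred\<close>)
  have separate constructors, which makes the two vocabularies disjoint.\<close>

datatype ('f, 'r, 'q) fm =
    Tru
  | Fls
  | Eq "'f tm" "'f tm"
  | Rel 'r "'f tm list"
  | Pred 'q "'f tm list"
  | Neg "('f, 'r, 'q) fm"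
  | And "('f, 'r, 'q) fm" "('f, 'r, 'q) fm"
  | Or "('f, 'r, 'q) fm" "('f, 'r, 'q) fm"

fun fm_vars :: "('f, 'r, 'q) fm \<Rightarrow> nat set" where
  "fm_vars Tru = {}"
| "fm_vars Fls = {}"
| "fm_vars (Eq s t) = tm_vars s \<union> tm_vars t"
| "fm_vars (Rel R ts) = (\<Union>t\<in>set ts. tm_vars t)"
| "fm_vars (Pred q ts) = (\<Union>t\<in>set ts. tm_vars t)"
| "fm_vars (Neg \<phi>) = fm_vars \<phi>"
| "fm_vars (And \<phi> \<psi>) = fm_vars \<phi> \<union> fm_vars \<psi>"
| "fm_vars (Or \<phi> \<psi>) = fm_vars \<phi> \<union> fm_vars \<psi>"

fun wf_fm :: "('f, 'r) vocab \<Rightarrow> 'q set \<Rightarrow> ('q \<Rightarrow> nat) \<Rightarrow> ('f, 'r, 'q) fm \<Rightarrow> bool" where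
  "wf_fm V Q ar Tru \<longleftrightarrow> True"
| "wf_fm V Q ar Fls \<longleftrightarrow> True"
| "wf_fm V Q ar (Eq s t) \<longleftrightarrow> wf_tm V s \<and> wf_tm V t"
| "wf_fm V Q ar (Rel R ts) \<longleftrightarrow> R \<in> rels V \<and> length ts = rel_ar V R \<and> (\<forall>t\<in>set ts. wf_tm V t)"
| "wf_fm V Q ar (Pred q ts) \<longleftrightarrow> q \<in> Q \<and> length ts = ar q \<and> (\<forall>t\<in>set ts. wf_tm V t)"
| "wf_fm V Q ar (Neg \<phi>) \<longleftrightarrow> wf_fm V Q ar \<phi>"
| "wf_fm V Q ar (And \<phi> \<psi>) \<longleftrightarrow> wf_fm V Q ar \<phi> \<and> wf_fm V Q ar \<psi>"
| "wf_fm V Q ar (Or \<phi> \<psi>) \<longleftrightarrow> wf_fm V Q ar \<phi> \<and> wf_fm V Q ar \<psi>"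

text \<open>The Boolean argument is the polarity of the current occurrence: true below an even number
  of negations, false below an odd number.\<close>

fun preds_positive :: "bool \<Rightarrow> ('f, 'r, 'q) fm \<Rightarrow> bool" where
  "preds_positive p Tru \<longleftrightarrow> True"
| "preds_positive p Fls \<longleftrightarrow> True"
| "preds_positive p (Eq s t) \<longleftrightarrow> True"
| "preds_positive p (Rel R ts) \<longleftrightarrow> True"
| "preds_positive p (Pred q ts) \<longleftrightarrow> p"
| "preds_positive p (Neg \<phi>) \<longleftrightarrow> preds_positive (\<not> p) \<phi>"
| "preds_positive p (And \<phi> \<psi>) \<longleftrightarrow> preds_positive p \<phi> \<and> preds_positive p \<psi>"
| "preds_positive p (Or \<phi> \<psi>) \<longleftrightarrow> preds_positive p \<phi> \<and> preds_positive p \<psi>"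

definition pos_fms :: "('f, 'r) vocab \<Rightarrow> 'q set \<Rightarrow> ('q \<Rightarrow> nat) \<Rightarrow> ('f, 'r, 'q) fm set" where
  "pos_fms V Q ar = {\<phi>. wf_fm V Q ar \<phi> \<and> preds_positive True \<phi>}"

section \<open>Negation-free Boolean combinations and their disjunctive normal form\<close>

datatype 'x pbf =
    PTrue
  | PFalse
  | PAtom 'x
  | PAnd "'x pbf" "'x pbf"
  | POr "'x pbf" "'x pbf"

fun dnf :: "'x pbf \<Rightarrow> 'x set set" where
  "dnf PTrue = {{}}"
| "dnf PFalse = {}"
| "dnf (PAtom x) = {{x}}"
| "dnf (PAnd a b) = {C \<union> D | C D. C \<in> dnf a \<and> D \<in> dnf b}"
| "dnf (POr a b) = dnf a \<union> dnf b"

text \<open>The cubes of the conjunction of \<open>h t\<close> over all \<open>t \<in> C\<close>: choose one cube for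
  each conjunct and take the union. The lemma below confirms that this is the
  disjunctive normal form of the conjunction.\<close>

definition dnf_conj :: "('t \<Rightarrow> 'x pbf) \<Rightarrow> 't set \<Rightarrow> 'x set set" where
  "dnf_conj h C = {(\<Union>t\<in>C. g t) | g. \<forall>t\<in>C. g t \<in> dnf (h t)}"

lemma dnf_conj_empty: "dnf_conj h {} = {{}}"
  by (auto simp: dnf_conj_def)

lemma dnf_conj_insert:
  assumes "t \<notin> C"
  shows "dnf_conj h (insert t C) = {D \<union> E | D E. D \<in> dnf (h t) \<and> E \<in> dnf_conj h C}"
proof (intro set_eqI iffI)
  fix X assume "X \<in> dnf_conj h (insert t C)"
  then show "X \<in> {D \<union> E | D E. D \<in> dnf (h t) \<and> E \<in> dnf_conj h C}"
    unfolding dnf_conj_def by auto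
next
  fix X assume "X \<in> {D \<union> E | D E. D \<in> dnf (h t) \<and> E \<in> dnf_conj h C}"
  then obtain D g where D: "D \<in> dnf (h t)" and g: "\<forall>u\<in>C. g u \<in> dnf (h u)"
    and X: "X = D \<union> (\<Union>u\<in>C. g u)"
    unfolding dnf_conj_def by blast
  define g' where "g' = g(t := D)"
  have "\<forall>u\<in>insert t C. g' u \<in> dnf (h u)" using D g by (simp add: g'_def)
  moreover have "(\<Union>u\<in>C. g' u) = (\<Union>u\<in>C. g u)"
    using assms by (intro SUP_cong) (auto simp: g'_def)
  then have "X = g' t \<union> (\<Union>u\<in>C. g' u)" using X unfolding g'_def by (simp only: fun_upd_same)
  then have "X = (\<Union>u\<in>insert t C. g' u)" by (simp only: UN_insert)
  ultimately show "X \<in> dnf_conj h (insert t C)" unfolding dnf_conj_def by blast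
qed

lemma dnf_conj_list:
  "distinct ts \<Longrightarrow> dnf (foldr (\<lambda>t. PAnd (h t)) ts PTrue) = dnf_conj h (set ts)"
  by (induction ts) (simp_all add: dnf_conj_empty dnf_conj_insert)

section \<open>Predicate automata\<close>

type_synonym ('q, 'a) state = "'q \<times> 'a list"

text \<open>Evaluation of a formula to a negation-free combination of ground atoms, with negations
  pushed inwards; the Boolean argument is again the polarity. Negative occurrences of \<open>Pred\<close>
  do not arise for formulas in \<open>pos_fms\<close>.\<close>

fun fm_eval ::
  "('f, 'r, 'a) struct \<Rightarrow> (nat \<Rightarrow> 'a) \<Rightarrow> bool \<Rightarrow> ('f, 'r, 'q) fm \<Rightarrow> ('q, 'a) state pbf" where
  "fm_eval T e p Tru = (if p then PTrue else PFalse)"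
| "fm_eval T e p Fls = (if p then PFalse else PTrue)"
| "fm_eval T e p (Eq s t) = (if (tm_val T e s = tm_val T e t) = p then PTrue else PFalse)"
| "fm_eval T e p (Rel R ts) = (if rel_int T R (map (tm_val T e) ts) = p then PTrue else PFalse)"
| "fm_eval T e p (Pred q ts) = (if p then PAtom (q, map (tm_val T e) ts) else PFalse)"
| "fm_eval T e p (Neg \<phi>) = fm_eval T e (\<not> p) \<phi>"
| "fm_eval T e p (And \<phi> \<psi>) = (if p then PAnd else POr) (fm_eval T e p \<phi>) (fm_eval T e p \<psi>)"
| "fm_eval T e p (Or \<phi> \<psi>) = (if p then POr else PAnd) (fm_eval T e p \<phi>) (fm_eval T e p \<psi>)"

record ('f, 'r, 'q, 's) pa =
  preds :: "'q set"
  ar :: "'q \<Rightarrow> nat"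
  delta :: "'q \<Rightarrow> 's \<Rightarrow> ('f, 'r, 'q) fm"
  start :: "('f, 'r, 'q) fm"
  final :: "'q set"

definition is_PA :: "('f, 'r) vocab \<Rightarrow> 's set \<Rightarrow> ('f, 'r, 'q, 's) pa \<Rightarrow> bool" where
  "is_PA V \<Sigma> A \<longleftrightarrow>
     finite (preds A) \<and>
     start A \<in> pos_fms V (preds A) (ar A) \<and> fm_vars (start A) = {} \<and>
     final A \<subseteq> preds A \<and>
     (\<forall>q\<in>preds A. \<forall>\<sigma>\<in>\<Sigma>.
        delta A q \<sigma> \<in> pos_fms V (preds A) (ar A) \<and> fm_vars (delta A q \<sigma>) \<subseteq> {0..ar A q})"

text \<open>The arity of an automaton without predicate symbols is 0.\<close>

definition pa_arity :: "('f, 'r, 'q, 's) pa \<Rightarrow> nat" where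
  "pa_arity A = Max (insert 0 (ar A ` preds A))"

definition monadic :: "('f, 'r, 'q, 's) pa \<Rightarrow> bool" where
  "monadic A \<longleftrightarrow> pa_arity A = 1"

definition states :: "('f, 'r, 'a) struct \<Rightarrow> ('f, 'r, 'q, 's) pa \<Rightarrow> ('q, 'a) state set" where
  "states T A = {(q, as). q \<in> preds A \<and> as \<in> lists (univ T) \<and> length as = ar A q}"

definition configuration ::
  "('f, 'r, 'a) struct \<Rightarrow> ('f, 'r, 'q, 's) pa \<Rightarrow> ('q, 'a) state set \<Rightarrow> bool" where
  "configuration T A C \<longleftrightarrow> finite C \<and> C \<subseteq> states T A"

definition delta_hat ::
  "('f, 'r, 'a) struct \<Rightarrow> ('f, 'r, 'q, 's) pa \<Rightarrow> ('q, 'a) state \<Rightarrow> 's \<times> 'a \<Rightarrow> ('q, 'a) state pbf" where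
  "delta_hat T A = (\<lambda>(q, as) (\<sigma>, a). fm_eval T (\<lambda>i. (a # as) ! i) True (delta A q \<sigma>))"

definition initial ::
  "('f, 'r, 'a) struct \<Rightarrow> ('f, 'r, 'q, 's) pa \<Rightarrow> ('q, 'a) state set \<Rightarrow> bool" where
  "initial T A C \<longleftrightarrow> C \<in> dnf (fm_eval T (\<lambda>_. undefined) True (start A))"

definition accepting :: "('f, 'r, 'q, 's) pa \<Rightarrow> ('q, 'a) state set \<Rightarrow> bool" where
  "accepting A C \<longleftrightarrow> (\<forall>(q, as)\<in>C. q \<in> final A)"

definition step ::
  "('f, 'r, 'a) struct \<Rightarrow> ('f, 'r, 'q, 's) pa \<Rightarrow> ('q, 'a) state set \<Rightarrow> 's \<times> 'a \<Rightarrow>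
     ('q, 'a) state set \<Rightarrow> bool" where
  "step T A C l C' \<longleftrightarrow> C' \<in> dnf_conj (\<lambda>t. delta_hat T A t l) C"

text \<open>Words are read from right to left. The \<open>r\<close>-th letter is \<open>w ! (r - 1)\<close>.\<close>

definition accepts ::
  "('f, 'r, 'a) struct \<Rightarrow> ('f, 'r, 'q, 's) pa \<Rightarrow> ('s \<times> 'a) list \<Rightarrow> bool" where
  "accepts T A w \<longleftrightarrow>
     (\<exists>C :: nat \<Rightarrow> ('q, 'a) state set.
        (\<forall>r\<le>length w. configuration T A (C r)) \<and>
        initial T A (C (length w)) \<and> accepting A (C 0) \<and>
        (\<forall>r\<in>{1..length w}. step T A (C r) (w ! (r - 1)) (C (r - 1))))"

definition lang ::
  "'s set \<Rightarrow> ('f, 'r, 'a) struct \<Rightarrow> ('f, 'r, 'q, 's) pa \<Rightarrow> ('s \<times> 'a) list set" where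
  "lang \<Sigma> T A = {w \<in> words \<Sigma> T. accepts T A w}"

text \<open>Automata have finitely many predicate symbols, and renaming these does not affect the
  language, so it is no restriction to take them from \<^typ>\<open>nat\<close>.\<close>

definition PAL ::
  "('f, 'r) vocab \<Rightarrow> ('f, 'r, 'a) struct \<Rightarrow> 's set \<Rightarrow> ('s \<times> 'a) list set \<Rightarrow> bool" where
  "PAL V T \<Sigma> L \<longleftrightarrow> (\<exists>A :: ('f, 'r, nat, 's) pa. is_PA V \<Sigma> A \<and> lang \<Sigma> T A = L)"

definition monadic_PAL ::
  "('f, 'r) vocab \<Rightarrow> ('f, 'r, 'a) struct \<Rightarrow> 's set \<Rightarrow> ('s \<times> 'a) list set \<Rightarrow> bool" where
  "monadic_PAL V T \<Sigma> L \<longleftrightarrow>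
     (\<exists>A :: ('f, 'r, nat, 's) pa. is_PA V \<Sigma> A \<and> monadic A \<and> lang \<Sigma> T A = L)"

end

theory Submission
  imports Defs
begin

text \<open>A predicate automaton is an alternating automaton run from the last letter to the first, so
  each word \<open>w\<close> assigns a truth value to every state, computed by recursion on \<open>w\<close>: it is the truth
  value of the transition formula under the assignment given by the remaining prefix. By
  positivity, \<open>w\<close> is accepted iff the start formula holds under this assignment. Now
  intersection is the conjunction of the start formulas over the disjoint union of the predicates;
  complementation replaces every formula by its dual, every state then receiving the
  negated truth value; and an isomorphism of generated substructures carries the assignment
  of one word to that of the other.\<close>

section \<open>Two-valued semantics\<close>

text \<open>Unlike \<open>fm_eval\<close>, this gives predicate atoms their truth value under
  negations too, so it also interprets formulas that are not positive, such as those built by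
  \<open>neg_preds\<close>.\<close>

fun holds ::
  "('f, 'r, 'a) struct \<Rightarrow> (nat \<Rightarrow> 'a) \<Rightarrow> (('q, 'a) state \<Rightarrow> bool) \<Rightarrow> ('f, 'r, 'q) fm \<Rightarrow> bool" where
  "holds T e I Tru \<longleftrightarrow> True"
| "holds T e I Fls \<longleftrightarrow> False"
| "holds T e I (Eq s t) \<longleftrightarrow> tm_val T e s = tm_val T e t"
| "holds T e I (Rel R ts) \<longleftrightarrow> rel_int T R (map (tm_val T e) ts)"
| "holds T e I (Pred q ts) \<longleftrightarrow> I (q, map (tm_val T e) ts)"
| "holds T e I (Neg \<phi>) \<longleftrightarrow> \<not> holds T e I \<phi>"
| "holds T e I (And \<phi> \<psi>) \<longleftrightarrow> holds T e I \<phi> \<and> holds T e I \<psi>"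
| "holds T e I (Or \<phi> \<psi>) \<longleftrightarrow> holds T e I \<phi> \<or> holds T e I \<psi>"

text \<open>Phrased through cubes, so that a witness is a candidate for the next configuration of a
  run; the usual truth clauses follow as simp rules.\<close>

definition pbf_sat :: "('x \<Rightarrow> bool) \<Rightarrow> 'x pbf \<Rightarrow> bool" where
  "pbf_sat I b \<longleftrightarrow> (\<exists>C\<in>dnf b. \<forall>x\<in>C. I x)"

lemma pbf_sat_simps [simp]:
  "pbf_sat I PTrue"
  "\<not> pbf_sat I PFalse"
  "pbf_sat I (PAtom x) \<longleftrightarrow> I x"
  "pbf_sat I (PAnd a b) \<longleftrightarrow> pbf_sat I a \<and> pbf_sat I b"
  "pbf_sat I (POr a b) \<longleftrightarrow> pbf_sat I a \<or> pbf_sat I b"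
proof -
  show "pbf_sat I (PAnd a b) \<longleftrightarrow> pbf_sat I a \<and> pbf_sat I b"
  proof
    assume "pbf_sat I (PAnd a b)"
    then show "pbf_sat I a \<and> pbf_sat I b" unfolding pbf_sat_def by auto
  next
    assume "pbf_sat I a \<and> pbf_sat I b"
    then obtain C D where "C \<in> dnf a" "D \<in> dnf b" "\<forall>x\<in>C \<union> D. I x"
      unfolding pbf_sat_def by blast
    moreover from this have "C \<union> D \<in> dnf (PAnd a b)" by auto
    ultimately show "pbf_sat I (PAnd a b)" unfolding pbf_sat_def by blast
  qed
qed (auto simp: pbf_sat_def)

text \<open>The polarity varies in the induction because \<open>Neg\<close> flips it. Positivity
  excludes the negative predicate atoms, which \<open>fm_eval\<close> sends to \<open>PFalse\<close>
  whatever \<open>I\<close> is.\<close>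

lemma pbf_sat_fm_eval:
  "preds_positive p \<phi> \<Longrightarrow> pbf_sat I (fm_eval T e p \<phi>) \<longleftrightarrow> holds T e I \<phi> = p"
  by (induction \<phi> arbitrary: p) auto

text \<open>A satisfied cube of the conjunction contains a cube of each conjunct; conversely, one
  satisfied cube is chosen per conjunct and their union taken.\<close>

lemma dnf_conj_sat:
  "(\<exists>D\<in>dnf_conj h C. \<forall>x\<in>D. I x) \<longleftrightarrow> (\<forall>t\<in>C. pbf_sat I (h t))"
proof
  assume "\<exists>D\<in>dnf_conj h C. \<forall>x\<in>D. I x"
  then show "\<forall>t\<in>C. pbf_sat I (h t)" unfolding dnf_conj_def pbf_sat_def by blast
next
  assume "\<forall>t\<in>C. pbf_sat I (h t)"
  then have "\<forall>t\<in>C. \<exists>D. D \<in> dnf (h t) \<and> (\<forall>x\<in>D. I x)" unfolding pbf_sat_def by blast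
  from bchoice[OF this] obtain g where "\<forall>t\<in>C. g t \<in> dnf (h t) \<and> (\<forall>x\<in>g t. I x)" by blast
  then have "(\<Union>t\<in>C. g t) \<in> dnf_conj h C" "\<forall>x\<in>\<Union>t\<in>C. g t. I x"
    unfolding dnf_conj_def by auto
  then show "\<exists>D\<in>dnf_conj h C. \<forall>x\<in>D. I x" by blast
qed

lemma finite_dnf: "C \<in> dnf b \<Longrightarrow> finite C"
  by (induction b arbitrary: C) auto

lemma dnf_subset_atoms: "C \<in> dnf b \<Longrightarrow> C \<subseteq> set_pbf b"
  by (induction b arbitrary: C) fastforce+

text \<open>The words below are reversed, so that the recursion reads the last letter first.\<close>

primrec state_val ::
  "('f, 'r, 'a) struct \<Rightarrow> ('f, 'r, 'q, 's) pa \<Rightarrow> ('s \<times> 'a) list \<Rightarrow> ('q, 'a) state \<Rightarrow> bool" where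
  "state_val T A [] = (\<lambda>(q, as). q \<in> final A)"
| "state_val T A (l # u) = (\<lambda>(q, as).
     holds T (\<lambda>i. (snd l # as) ! i) (state_val T A u) (delta A q (fst l)))"

text \<open>Stated for any closed \<open>D\<close>, to serve both the whole universe and generated
  substructures.\<close>

lemma tm_val_in:
  assumes "closed_in V T D" "wf_tm V t" "\<And>i. i \<in> tm_vars t \<Longrightarrow> e i \<in> D"
  shows "tm_val T e t \<in> D"
  using assms(2,3)
proof (induction t)
  case (Var i)
  then show ?case by simp
next
  case (Fun f ts)
  then have "\<forall>t\<in>set ts. tm_val T e t \<in> D" by auto
  then have "map (tm_val T e) ts \<in> lists D" by auto
  then show ?case using assms(1) Fun.prems(1) by (simp add: closed_in_def)
qed

lemma fm_eval_atoms:
  assumes "is_struct V T" "wf_fm V (preds A) (ar A) \<phi>" "\<And>i. i \<in> fm_vars \<phi> \<Longrightarrow> e i \<in> univ T"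
  shows "set_pbf (fm_eval T e p \<phi>) \<subseteq> states T A"
  using assms(2,3)
proof (induction \<phi> arbitrary: p)
  case (Pred q ts)
  then have "\<forall>t\<in>set ts. tm_val T e t \<in> univ T"
    using assms(1) by (auto simp: is_struct_def intro!: tm_val_in[of V T "univ T"])
  then show ?case using Pred by (auto simp: states_def)
qed (auto split: if_splits)

text \<open>One unfolding of \<open>state_val\<close> matches one transition: positivity of
  \<open>delta\<close> lets \<open>pbf_sat_fm_eval\<close> turn cubes into truth.\<close>

lemma delta_hat_sat:
  assumes "is_PA V \<Sigma> A" "t \<in> states T A" "l \<in> \<Sigma> \<times> univ T"
  shows "pbf_sat (state_val T A u) (delta_hat T A t l) \<longleftrightarrow> state_val T A (l # u) t"
  using assms
  by (cases t; cases l) (auto simp: delta_hat_def is_PA_def pos_fms_def states_def pbf_sat_fm_eval)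

text \<open>Index 0 is the letter being read and indices 1 to \<open>length as\<close> are the
  arguments of the state, hence the inclusive bound.\<close>

lemma nth_env_in:
  assumes "set as \<subseteq> D" "a \<in> D" "i \<in> {0..length as}"
  shows "(a # as) ! i \<in> D"
proof -
  have "(a # as) ! i \<in> set (a # as)" using assms(3) by (intro nth_mem) auto
  then show ?thesis using assms(1,2) by auto
qed

lemma delta_hat_atoms:
  assumes "is_struct V T" "is_PA V \<Sigma> A" "t \<in> states T A" "l \<in> \<Sigma> \<times> univ T"
  shows "set_pbf (delta_hat T A t l) \<subseteq> states T A"
proof -
  obtain q as \<sigma> a where tl: "t = (q, as)" "l = (\<sigma>, a)" by (cases t; cases l)
  have q: "q \<in> preds A" "set as \<subseteq> univ T" "length as = ar A q" "\<sigma> \<in> \<Sigma>" "a \<in> univ T"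
    using assms(3,4) tl by (auto simp: states_def)
  have wf: "wf_fm V (preds A) (ar A) (delta A q \<sigma>)" "fm_vars (delta A q \<sigma>) \<subseteq> {0..ar A q}"
    using assms(2) q by (auto simp: is_PA_def pos_fms_def)
  have "set_pbf (fm_eval T (\<lambda>i. (a # as) ! i) True (delta A q \<sigma>)) \<subseteq> states T A"
    by (rule fm_eval_atoms[OF assms(1) wf(1)]) (use q wf(2) nth_env_in[of as "univ T" a] in auto)
  then show ?thesis by (simp add: tl delta_hat_def)
qed

section \<open>Runs and the truth of states\<close>

lemma step_configuration:
  assumes "is_struct V T" "is_PA V \<Sigma> A" "configuration T A C" "l \<in> \<Sigma> \<times> univ T" "step T A C l C'"
  shows "configuration T A C'"
proof -
  obtain g where g: "C' = (\<Union>t\<in>C. g t)" "\<forall>t\<in>C. g t \<in> dnf (delta_hat T A t l)"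
    using assms(5) unfolding step_def dnf_conj_def by blast
  have "\<forall>t\<in>C. finite (g t) \<and> g t \<subseteq> states T A"
    using g(2) assms(3) finite_dnf dnf_subset_atoms delta_hat_atoms[OF assms(1,2) _ assms(4)]
    unfolding configuration_def by blast
  then show ?thesis using assms(3) g(1) unfolding configuration_def by auto
qed

text \<open>A run is built greedily: a true state has a cube of true states for the letter read, so
  truth can be kept down to the empty prefix, where it means being final. \<open>D\<close> is
  generalised since it changes with each letter.\<close>

lemma run_from_configuration:
  assumes "is_struct V T" "is_PA V \<Sigma> A"
    and "w \<in> words \<Sigma> T" "configuration T A D" "\<forall>t\<in>D. state_val T A (rev w) t"
  shows "\<exists>C. (\<forall>r\<le>length w. configuration T A (C r)) \<and> C (length w) = D \<and> accepting A (C 0) \<and>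
    (\<forall>r\<in>{1..length w}. step T A (C r) (w ! (r - 1)) (C (r - 1)))"
  using assms(3-)
proof (induction w arbitrary: D rule: rev_induct)
  case Nil
  then show ?case by (intro exI[of _ "\<lambda>_. D"]) (auto simp: accepting_def)
next
  case (snoc l w)
  have l: "l \<in> \<Sigma> \<times> univ T" and w: "w \<in> words \<Sigma> T"
    using snoc.prems(1) by (auto simp: words_def)
  have "\<forall>t\<in>D. pbf_sat (state_val T A (rev w)) (delta_hat T A t l)"
    using snoc.prems(2,3) delta_hat_sat[OF assms(2) _ l, of _ "rev w"]
    unfolding configuration_def rev.simps rev_append append.simps by blast
  then obtain D' where D': "step T A D l D'" "\<forall>t\<in>D'. state_val T A (rev w) t"
    unfolding step_def dnf_conj_sat[symmetric] by blast
  obtain C where C: "\<forall>r\<le>length w. configuration T A (C r)" "C (length w) = D'" "accepting A (C 0)"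
    "\<forall>r\<in>{1..length w}. step T A (C r) (w ! (r - 1)) (C (r - 1))"
    using snoc.IH[OF w step_configuration[OF assms(1,2) snoc.prems(2) l D'(1)] D'(2)] by blast
  \<comment> \<open>Indices count the letters still unread, so the run from \<open>D'\<close> keeps
    its numbering and \<open>D\<close> goes on top.\<close>
  define C' where "C' = C(Suc (length w) := D)"
  have "\<forall>r\<in>{1..Suc (length w)}. step T A (C' r) ((w @ [l]) ! (r - 1)) (C' (r - 1))"
  proof
    fix r assume r: "r \<in> {1..Suc (length w)}"
    show "step T A (C' r) ((w @ [l]) ! (r - 1)) (C' (r - 1))"
    proof (cases "r = Suc (length w)")
      case True
      then show ?thesis using D'(1) C(2) by (simp add: C'_def)
    next
      case False
      then show ?thesis using r C(4) by (auto simp: C'_def nth_append)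
    qed
  qed
  moreover have "\<forall>r\<le>Suc (length w). configuration T A (C' r)"
    using C(1) snoc.prems(2) by (auto simp: C'_def le_Suc_eq)
  ultimately show ?case using C(3) by (intro exI[of _ C']) (auto simp: C'_def)
qed

text \<open>Conversely, truth climbs from the accepting configuration: if all states of
  \<open>C r\<close> are true for the first \<open>r\<close> letters, they witness satisfaction of
  the transition formulas of \<open>C (Suc r)\<close>.\<close>

lemma run_state_val:
  assumes "is_PA V \<Sigma> A" "w \<in> words \<Sigma> T"
    and "\<forall>r\<le>length w. configuration T A (C r)" "accepting A (C 0)"
    and "\<forall>r\<in>{1..length w}. step T A (C r) (w ! (r - 1)) (C (r - 1))"
  shows "r \<le> length w \<Longrightarrow> \<forall>t\<in>C r. state_val T A (rev (take r w)) t"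
proof (induction r)
  case 0
  then show ?case using assms(4) by (auto simp: accepting_def)
next
  case (Suc r)
  have "w ! r \<in> set w" using Suc.prems by simp
  then have l: "w ! r \<in> \<Sigma> \<times> univ T" using assms(2) by (auto simp: words_def)
  have "step T A (C (Suc r)) (w ! r) (C r)" using bspec[OF assms(5), of "Suc r"] Suc.prems by simp
  then have "\<forall>t\<in>C (Suc r). pbf_sat (state_val T A (rev (take r w))) (delta_hat T A t (w ! r))"
    using Suc unfolding step_def dnf_conj_sat[symmetric] by auto
  moreover have "C (Suc r) \<subseteq> states T A" using assms(3) Suc.prems by (auto simp: configuration_def)
  ultimately have "\<forall>t\<in>C (Suc r). state_val T A (w ! r # rev (take r w)) t"
    using delta_hat_sat[OF assms(1) _ l] by blast
  then show ?case using Suc.prems by (simp add: take_Suc_conv_app_nth)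
qed

lemma accepts_iff_holds:
  assumes "is_struct V T" "is_PA V \<Sigma> A" "w \<in> words \<Sigma> T"
  shows "accepts T A w \<longleftrightarrow> holds T (\<lambda>_. undefined) (state_val T A (rev w)) (start A)"
proof -
  have start: "wf_fm V (preds A) (ar A) (start A)" "preds_positive True (start A)"
    "fm_vars (start A) = {}"
    using assms(2) by (auto simp: is_PA_def pos_fms_def)
  have "accepts T A w \<longleftrightarrow> (\<exists>D. initial T A D \<and> (\<forall>t\<in>D. state_val T A (rev w) t))"
  proof
    assume "accepts T A w"
    then show "\<exists>D. initial T A D \<and> (\<forall>t\<in>D. state_val T A (rev w) t)"
      unfolding accepts_def using run_state_val[OF assms(2,3), of _ "length w"] by force
  next
    assume "\<exists>D. initial T A D \<and> (\<forall>t\<in>D. state_val T A (rev w) t)"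
    then obtain D where D: "initial T A D" "\<forall>t\<in>D. state_val T A (rev w) t" by blast
    \<comment> \<open>As \<open>start A\<close> has no variables, the undefined environment cannot
      bring foreign elements into its atoms.\<close>
    have "configuration T A D"
      using D(1) fm_eval_atoms[OF assms(1) start(1)] start(3) finite_dnf dnf_subset_atoms
      unfolding initial_def configuration_def by blast
    from run_from_configuration[OF assms this D(2)] show "accepts T A w"
      unfolding accepts_def using D(1) by blast
  qed
  then show ?thesis
    using pbf_sat_fm_eval[OF start(2), of "state_val T A (rev w)" T "\<lambda>_. undefined"]
    unfolding initial_def pbf_sat_def by auto
qed

lemma lang_eq_holds:
  assumes "is_struct V T" "is_PA V \<Sigma> A"
  shows "lang \<Sigma> T A =
    {w \<in> words \<Sigma> T. holds T (\<lambda>_. undefined) (state_val T A (rev w)) (start A)}"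
  using accepts_iff_holds[OF assms] unfolding lang_def by blast

section \<open>Intersection\<close>

lemma map_tm_ident [simp]: "map_tm (\<lambda>x. x) = (\<lambda>x. x)"
  by (rule ext) (rule tm.map_ident)

lemma holds_map_fm:
  "holds T e I (map_fm id id h \<phi>) = holds T e (\<lambda>(q, as). I (h q, as)) \<phi>"
  by (induction \<phi>) simp_all

lemma fm_vars_map_fm [simp]: "fm_vars (map_fm id id h \<phi>) = fm_vars \<phi>"
  by (induction \<phi>) simp_all

lemma preds_positive_map_fm [simp]: "preds_positive p (map_fm id id h \<phi>) = preds_positive p \<phi>"
  by (induction \<phi> arbitrary: p) simp_all

lemma wf_map_fm:
  assumes "wf_fm V Q \<alpha> \<phi>" "\<And>q. q \<in> Q \<Longrightarrow> h q \<in> Q' \<and> \<alpha>' (h q) = \<alpha> q"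
  shows "wf_fm V Q' \<alpha>' (map_fm id id h \<phi>)"
  using assms(1) by (induction \<phi>) (auto simp: assms(2) tm.map_id)

text \<open>Predicates of \<open>A\<close> become even and those of \<open>B\<close> odd: a disjoint
  union that stays within \<open>nat\<close>, as \<open>PAL\<close> requires.\<close>

definition inter_pa ::
  "('f, 'r, nat, 's) pa \<Rightarrow> ('f, 'r, nat, 's) pa \<Rightarrow> ('f, 'r, nat, 's) pa" where
  "inter_pa A B = \<lparr>
     preds = (\<lambda>q. 2 * q) ` preds A \<union> (\<lambda>q. Suc (2 * q)) ` preds B,
     ar = (\<lambda>q. if even q then ar A (q div 2) else ar B (q div 2)),
     delta = (\<lambda>q \<sigma>. if even q then map_fm id id (\<lambda>q. 2 * q) (delta A (q div 2) \<sigma>)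
                     else map_fm id id (\<lambda>q. Suc (2 * q)) (delta B (q div 2) \<sigma>)),
     start = And (map_fm id id (\<lambda>q. 2 * q) (start A)) (map_fm id id (\<lambda>q. Suc (2 * q)) (start B)),
     final = (\<lambda>q. 2 * q) ` final A \<union> (\<lambda>q. Suc (2 * q)) ` final B\<rparr>"

lemma is_PA_inter_pa:
  assumes A: "is_PA V \<Sigma> A" and B: "is_PA V \<Sigma> B"
  shows "is_PA V \<Sigma> (inter_pa A B)"
proof -
  let ?P = "preds (inter_pa A B)" and ?ar = "ar (inter_pa A B)"
  have wfA: "wf_fm V (preds A) (ar A) \<phi> \<Longrightarrow> wf_fm V ?P ?ar (map_fm id id (\<lambda>q. 2 * q) \<phi>)" for \<phi>
    by (rule wf_map_fm) (auto simp: inter_pa_def)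
  have wfB: "wf_fm V (preds B) (ar B) \<phi> \<Longrightarrow> wf_fm V ?P ?ar (map_fm id id (\<lambda>q. Suc (2 * q)) \<phi>)" for \<phi>
    by (rule wf_map_fm) (auto simp: inter_pa_def)
  have "start (inter_pa A B) \<in> pos_fms V ?P ?ar"
    using A B wfA[of "start A"] wfB[of "start B"]
    by (simp add: is_PA_def pos_fms_def) (simp add: inter_pa_def)
  moreover have "delta (inter_pa A B) q \<sigma> \<in> pos_fms V ?P ?ar"
    and "fm_vars (delta (inter_pa A B) q \<sigma>) \<subseteq> {0..?ar q}"
    if q: "q \<in> ?P" and \<sigma>: "\<sigma> \<in> \<Sigma>" for q \<sigma>
  proof -
    consider p where "q = 2 * p" "p \<in> preds A" | p where "q = Suc (2 * p)" "p \<in> preds B"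
      using q by (auto simp: inter_pa_def)
    then have "delta (inter_pa A B) q \<sigma> \<in> pos_fms V ?P ?ar \<and>
      fm_vars (delta (inter_pa A B) q \<sigma>) \<subseteq> {0..?ar q}"
    proof cases
      case 1
      have "delta (inter_pa A B) q \<sigma> = map_fm id id (\<lambda>q. 2 * q) (delta A p \<sigma>)" "?ar q = ar A p"
        using 1 by (simp_all add: inter_pa_def)
      then show ?thesis using A 1 \<sigma> wfA[of "delta A p \<sigma>"] by (simp add: is_PA_def pos_fms_def)
    next
      case 2
      have "delta (inter_pa A B) q \<sigma> = map_fm id id (\<lambda>q. Suc (2 * q)) (delta B p \<sigma>)" "?ar q = ar B p"
        using 2 by (simp_all add: inter_pa_def)
      then show ?thesis using B 2 \<sigma> wfB[of "delta B p \<sigma>"] by (simp add: is_PA_def pos_fms_def)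
    qed
    then show "delta (inter_pa A B) q \<sigma> \<in> pos_fms V ?P ?ar"
      and "fm_vars (delta (inter_pa A B) q \<sigma>) \<subseteq> {0..?ar q}" by blast+
  qed
  moreover have "finite ?P" "fm_vars (start (inter_pa A B)) = {}" "final (inter_pa A B) \<subseteq> ?P"
    using A B by (auto simp: is_PA_def inter_pa_def)
  ultimately show ?thesis unfolding is_PA_def by blast
qed

text \<open>Transition formulas of each half mention only predicates of that half, so pulling the
  valuation back along the renaming gives, by induction, the valuation of the component.\<close>

lemma state_val_inter_pa:
  "state_val T (inter_pa A B) u (2 * q, as) = state_val T A u (q, as)"
  "state_val T (inter_pa A B) u (Suc (2 * q), as) = state_val T B u (q, as)"
proof (induction u arbitrary: q as)
  case Nil
  have ne: "2 * p \<noteq> Suc (2 * p')" "Suc (2 * p') \<noteq> 2 * p" for p p' :: nat by presburger+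
  { case 1 then show ?case using ne by (auto simp: inter_pa_def) }
  { case 2 then show ?case using ne by (auto simp: inter_pa_def) }
next
  case (Cons l u)
  \<comment> \<open>Only the \<open>delta\<close> field is unfolded; \<open>inter_pa A B\<close>
    must stay folded inside \<open>state_val\<close> for the induction hypothesis to apply.\<close>
  { case 1 then show ?case
      by (simp add: inter_pa_def[of A B, THEN arg_cong[of _ _ delta]] holds_map_fm Cons.IH) }
  { case 2 then show ?case
      by (simp add: inter_pa_def[of A B, THEN arg_cong[of _ _ delta]] holds_map_fm Cons.IH) }
qed

lemma lang_inter_pa:
  assumes "is_struct V T" "is_PA V \<Sigma> A" "is_PA V \<Sigma> B"
  shows "lang \<Sigma> T (inter_pa A B) = lang \<Sigma> T A \<inter> lang \<Sigma> T B"
proof -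
  have start: "start (inter_pa A B) =
    And (map_fm id id (\<lambda>q. 2 * q) (start A)) (map_fm id id (\<lambda>q. Suc (2 * q)) (start B))"
    by (simp add: inter_pa_def)
  show ?thesis
    unfolding lang_eq_holds[OF assms(1) is_PA_inter_pa[OF assms(2,3)]]
      lang_eq_holds[OF assms(1,2)] lang_eq_holds[OF assms(1,3)]
    by (auto simp: start holds_map_fm state_val_inter_pa)
qed

text \<open>The exact value is wanted because \<open>monadic\<close> asks for arity equal to 1, not
  merely at most 1.\<close>

lemma pa_arity_inter_pa:
  assumes "is_PA V \<Sigma> A" "is_PA V \<Sigma> B"
  shows "pa_arity (inter_pa A B) = max (pa_arity A) (pa_arity B)"
proof -
  \<comment> \<open>0 is inserted into both sets, which makes each nonempty for
    \<open>Max_Un\<close>.\<close>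
  have "insert 0 (ar (inter_pa A B) ` preds (inter_pa A B)) =
    insert 0 (ar A ` preds A) \<union> insert 0 (ar B ` preds B)"
    by (simp add: inter_pa_def image_Un image_image del: if_image_distrib)
  then show ?thesis
    using assms unfolding pa_arity_def by (simp only:) (subst Max_Un; simp add: is_PA_def)
qed

section \<open>Complement\<close>

text \<open>Atoms over the vocabulary are left alone. For positive \<phi>,
  \<open>Neg (neg_preds \<phi>)\<close> is then the dual with respect to the automaton predicates:
  the outer negation makes their occurrences positive again.\<close>

fun neg_preds :: "('f, 'r, 'q) fm \<Rightarrow> ('f, 'r, 'q) fm" where
  "neg_preds (Pred q ts) = Neg (Pred q ts)"
| "neg_preds (Neg \<phi>) = Neg (neg_preds \<phi>)"
| "neg_preds (And \<phi> \<psi>) = And (neg_preds \<phi>) (neg_preds \<psi>)"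
| "neg_preds (Or \<phi> \<psi>) = Or (neg_preds \<phi>) (neg_preds \<psi>)"
| "neg_preds \<phi> = \<phi>"

lemma neg_preds_simps [simp]:
  "wf_fm V Q \<alpha> (neg_preds \<phi>) = wf_fm V Q \<alpha> \<phi>"
  "fm_vars (neg_preds \<phi>) = fm_vars \<phi>"
  by (induction \<phi>) simp_all

lemma preds_positive_neg_preds [simp]: "preds_positive p (neg_preds \<phi>) = preds_positive (\<not> p) \<phi>"
  by (induction \<phi> arbitrary: p) simp_all

text \<open>The negation inserted at each predicate atom cancels the one between \<open>I'\<close>
  and \<open>I\<close>. Well-formedness confines the atoms to \<open>Q\<close>, where the two are
  opposite.\<close>

lemma holds_neg_preds:
  assumes "wf_fm V Q \<alpha> \<phi>" "\<And>q as. q \<in> Q \<Longrightarrow> I' (q, as) \<longleftrightarrow> \<not> I (q, as)"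
  shows "holds T e I' (neg_preds \<phi>) = holds T e I \<phi>"
  using assms(1) by (induction \<phi>) (simp_all add: assms(2))

definition compl_pa :: "('f, 'r, 'q, 's) pa \<Rightarrow> ('f, 'r, 'q, 's) pa" where
  "compl_pa A = \<lparr>
     preds = preds A,
     ar = ar A,
     delta = (\<lambda>q \<sigma>. Neg (neg_preds (delta A q \<sigma>))),
     start = Neg (neg_preds (start A)),
     final = preds A - final A\<rparr>"

lemma is_PA_compl_pa: "is_PA V \<Sigma> A \<Longrightarrow> is_PA V \<Sigma> (compl_pa A)"
  by (auto simp: is_PA_def compl_pa_def pos_fms_def)

text \<open>Restricted to \<open>preds A\<close> and letters over \<Sigma>, where
  \<open>is_PA\<close> makes the transition formulas well-formed; on the empty word a foreign
  predicate is final in neither automaton.\<close>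

lemma state_val_compl_pa:
  assumes "is_PA V \<Sigma> A" "set (map fst u) \<subseteq> \<Sigma>" "q \<in> preds A"
  shows "state_val T (compl_pa A) u (q, as) \<longleftrightarrow> \<not> state_val T A u (q, as)"
  using assms(2,3)
proof (induction u arbitrary: q as)
  case Nil
  then show ?case by (simp add: compl_pa_def)
next
  case (Cons l u)
  have "wf_fm V (preds A) (ar A) (delta A q (fst l))"
    using assms(1) Cons.prems by (simp add: is_PA_def pos_fms_def)
  from holds_neg_preds[OF this, of "state_val T (compl_pa A) u"] Cons show ?case
    by (simp add: compl_pa_def[THEN arg_cong[of _ _ delta]])
qed

lemma lang_compl_pa:
  assumes "is_struct V T" "is_PA V \<Sigma> A"
  shows "lang \<Sigma> T (compl_pa A) = words \<Sigma> T - lang \<Sigma> T A"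
proof -
  have start: "start (compl_pa A) = Neg (neg_preds (start A))" by (simp add: compl_pa_def)
  have wf: "wf_fm V (preds A) (ar A) (start A)" using assms(2) by (simp add: is_PA_def pos_fms_def)
  have "holds T e (state_val T (compl_pa A) (rev w)) (neg_preds (start A)) =
      holds T e (state_val T A (rev w)) (start A)" if "w \<in> words \<Sigma> T" for w e
  proof (rule holds_neg_preds[OF wf], rule state_val_compl_pa[OF assms(2)])
    show "set (map fst (rev w)) \<subseteq> \<Sigma>" using that by (auto simp: words_def)
  qed
  then show ?thesis
    unfolding lang_eq_holds[OF assms(1) is_PA_compl_pa[OF assms(2)]] lang_eq_holds[OF assms]
    by (auto simp: start)
qed

lemma monadic_compl_pa [simp]: "monadic (compl_pa A) = monadic A"
  by (simp add: monadic_def pa_arity_def compl_pa_def)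

section \<open>Invariance under isomorphism of generated substructures\<close>

text \<open>An intersection of closed sets is closed; if no set qualifies, it is
  \<open>UNIV\<close>, which is closed too.\<close>

lemma closed_in_generated: "closed_in V T (univ (generated V T X))"
  unfolding closed_in_def generated_def by (simp add: lists_eq_set le_Inf_iff)

lemma subset_generated: "X \<subseteq> univ (generated V T X)"
  unfolding generated_def by auto

text \<open>Closure keeps the values of subterms in \<open>D\<close>, where \<beta> is known to
  respect the functions.\<close>

lemma tm_val_hom:
  assumes "closed_in V T D"
    and hom: "\<forall>f\<in>funs V. \<forall>xs\<in>lists D. length xs = fun_ar V f \<longrightarrow>
      \<beta> (fun_int T f xs) = fun_int T f (map \<beta> xs)"
    and "wf_tm V t" "\<And>i. i \<in> tm_vars t \<Longrightarrow> e i \<in> D \<and> e' i = \<beta> (e i)"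
  shows "tm_val T e' t = \<beta> (tm_val T e t)"
  using assms(3,4)
proof (induction t)
  case (Var i)
  then show ?case by simp
next
  case (Fun f ts)
  have "\<forall>t\<in>set ts. tm_val T e t \<in> D"
    using Fun.prems by (auto intro!: tm_val_in[OF assms(1)])
  then have "map (tm_val T e) ts \<in> lists D" by auto
  then have "\<beta> (fun_int T f (map (tm_val T e) ts)) = fun_int T f (map \<beta> (map (tm_val T e) ts))"
    using hom Fun.prems(1) by simp
  moreover have "map (tm_val T e') ts = map \<beta> (map (tm_val T e) ts)" using Fun by auto
  ultimately show ?case by (simp only: tm_val.simps)
qed

text \<open>Embeddings preserve quantifier-free truth in both directions: injectivity settles
  equations, \<open>rel\<close> the relational atoms, and compatibility of \<open>I\<close> and
  \<open>I'\<close> the predicate atoms.\<close>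

lemma holds_iso:
  assumes "closed_in V T D" "inj_on \<beta> D"
    and hom: "\<forall>f\<in>funs V. \<forall>xs\<in>lists D. length xs = fun_ar V f \<longrightarrow>
      \<beta> (fun_int T f xs) = fun_int T f (map \<beta> xs)"
    and rel: "\<forall>R\<in>rels V. \<forall>xs\<in>lists D. length xs = rel_ar V R \<longrightarrow>
      (rel_int T R xs \<longleftrightarrow> rel_int T R (map \<beta> xs))"
    and I: "\<And>q xs. q \<in> Q \<Longrightarrow> xs \<in> lists D \<Longrightarrow> length xs = \<alpha> q \<Longrightarrow> I' (q, map \<beta> xs) = I (q, xs)"
    and "wf_fm V Q \<alpha> \<phi>" "\<And>i. i \<in> fm_vars \<phi> \<Longrightarrow> e i \<in> D \<and> e' i = \<beta> (e i)"
  shows "holds T e' I' \<phi> = holds T e I \<phi>"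
  using assms(6,7)
proof (induction \<phi>)
  case (Eq s t)
  then have "tm_val T e s \<in> D" "tm_val T e t \<in> D" using tm_val_in[OF assms(1)] by auto
  then show ?case
    using Eq tm_val_hom[OF assms(1) hom, of _ e e'] inj_on_eq_iff[OF assms(2)] by simp
next
  case (Rel R ts)
  have "\<forall>t\<in>set ts. tm_val T e t \<in> D \<and> tm_val T e' t = \<beta> (tm_val T e t)"
    using Rel by (auto intro!: tm_val_in[OF assms(1)] tm_val_hom[OF assms(1) hom])
  then have "map (tm_val T e) ts \<in> lists D" "map (tm_val T e') ts = map \<beta> (map (tm_val T e) ts)"
    by auto
  \<comment> \<open>Disabling \<open>map_map\<close> keeps the nested maps in the shape in which
    \<open>rel\<close> applies.\<close>
  then show ?case using rel Rel.prems(1) by (simp del: map_map)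
next
  case (Pred q ts)
  have "\<forall>t\<in>set ts. tm_val T e t \<in> D \<and> tm_val T e' t = \<beta> (tm_val T e t)"
    using Pred by (auto intro!: tm_val_in[OF assms(1)] tm_val_hom[OF assms(1) hom])
  then have "map (tm_val T e) ts \<in> lists D" "map (tm_val T e') ts = map \<beta> (map (tm_val T e) ts)"
    by auto
  then show ?case using I Pred.prems(1) by (simp del: map_map)
qed simp_all

text \<open>The arguments \<open>as\<close> are generalised because a transition may move to other
  tuples over \<open>D\<close>. The induction hypothesis is the compatibility of valuations that
  \<open>holds_iso\<close> needs.\<close>

lemma state_val_iso:
  assumes "is_PA V \<Sigma> A" "closed_in V T D" "inj_on \<beta> D"
    and hom: "\<forall>f\<in>funs V. \<forall>xs\<in>lists D. length xs = fun_ar V f \<longrightarrow>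
      \<beta> (fun_int T f xs) = fun_int T f (map \<beta> xs)"
    and rel: "\<forall>R\<in>rels V. \<forall>xs\<in>lists D. length xs = rel_ar V R \<longrightarrow>
      (rel_int T R xs \<longleftrightarrow> rel_int T R (map \<beta> xs))"
    and "u \<in> lists (\<Sigma> \<times> D)" "q \<in> preds A" "as \<in> lists D" "length as = ar A q"
  shows "state_val T A (map (map_prod id \<beta>) u) (q, map \<beta> as) = state_val T A u (q, as)"
  using assms(6-)
proof (induction u arbitrary: q as rule: list.induct)
  case Nil
  then show ?case by simp
next
  case (Cons l u)
  have u: "u \<in> lists (\<Sigma> \<times> D)" and l: "fst l \<in> \<Sigma>" "snd l \<in> D"
    using Cons.prems(1) by auto
  have d: "wf_fm V (preds A) (ar A) (delta A q (fst l))" "fm_vars (delta A q (fst l)) \<subseteq> {0..ar A q}"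
    using assms(1) Cons.prems(2) l by (auto simp: is_PA_def pos_fms_def)
  have "holds T (\<lambda>i. (\<beta> (snd l) # map \<beta> as) ! i) (state_val T A (map (map_prod id \<beta>) u))
      (delta A q (fst l)) = holds T (\<lambda>i. (snd l # as) ! i) (state_val T A u) (delta A q (fst l))"
  proof (rule holds_iso[OF assms(2,3) hom rel _ d(1)])
    show "state_val T A (map (map_prod id \<beta>) u) (q, map \<beta> xs) = state_val T A u (q, xs)"
      if "q \<in> preds A" "xs \<in> lists D" "length xs = ar A q" for q xs
      using Cons.IH[OF u that] .
    fix i assume "i \<in> fm_vars (delta A q (fst l))"
    then have i: "i \<in> {0..length as}" using d(2) Cons.prems(4) by auto
    have "(map \<beta> (snd l # as)) ! i = \<beta> ((snd l # as) ! i)" using i by (intro nth_map) auto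
    then show "(snd l # as) ! i \<in> D \<and> (\<beta> (snd l) # map \<beta> as) ! i = \<beta> ((snd l # as) ! i)"
      using nth_env_in[OF _ l(2) i] Cons.prems(3) by auto
  qed
  then show ?case by (cases l) (simp add: id_def)
qed

lemma lang_word_equiv:
  assumes T: "is_struct V T" and A: "is_PA V \<Sigma> A"
    and w: "w \<in> lang \<Sigma> T A" "w' \<in> words \<Sigma> T" "word_equiv V T w w'"
  shows "w' \<in> lang \<Sigma> T A"
proof -
  obtain \<beta> where iso: "is_iso V (generated V T (set (map snd w))) (generated V T (set (map snd w'))) \<beta>"
    and \<beta>: "map \<beta> (map snd w) = map snd w'" and fst: "map fst w = map fst w'"
    using w(3) unfolding word_equiv_def tuple_equiv_def by blast
  \<comment> \<open>Containing all letters of the word and closed under the functions,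
    \<open>D\<close> holds every element met in the computation.\<close>
  define D where "D = univ (generated V T (set (map snd w)))"
  \<comment> \<open>\<open>generated\<close> changes only the universe, so the clauses of
    \<open>is_iso\<close> speak about the functions and relations of \<open>T\<close>.\<close>
  have T_gen: "fun_int (generated V T X) = fun_int T" "rel_int (generated V T X) = rel_int T" for X
    by (simp_all add: generated_def)
  have inj: "inj_on \<beta> D"
    and hom: "\<forall>f\<in>funs V. \<forall>xs\<in>lists D. length xs = fun_ar V f \<longrightarrow>
      \<beta> (fun_int T f xs) = fun_int T f (map \<beta> xs)"
    and rel: "\<forall>R\<in>rels V. \<forall>xs\<in>lists D. length xs = rel_ar V R \<longrightarrow>
      (rel_int T R xs \<longleftrightarrow> rel_int T R (map \<beta> xs))"
    using iso unfolding is_iso_def D_def T_gen bij_betw_def by blast+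
  have closed: "closed_in V T D" unfolding D_def by (rule closed_in_generated)
  have wD: "rev w \<in> lists (\<Sigma> \<times> D)"
    using w(1) subset_generated[of "set (map snd w)" V T] unfolding D_def
    by (force simp: lang_def words_def)
  have "map fst (map (map_prod id \<beta>) w) = map fst w'" "map snd (map (map_prod id \<beta>) w) = map snd w'"
    using fst \<beta> by (simp_all add: comp_def)
  then have w': "w' = map (map_prod id \<beta>) w" by (metis zip_map_fst_snd)
  have start: "wf_fm V (preds A) (ar A) (start A)" "fm_vars (start A) = {}"
    using A by (auto simp: is_PA_def pos_fms_def)
  \<comment> \<open>Without variables in \<open>start A\<close>, the condition of
    \<open>holds_iso\<close> on environments is vacuous; \<open>state_val_iso\<close> supplies the
    one on valuations.\<close>
  have "holds T (\<lambda>_. undefined) (state_val T A (rev w')) (start A) =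
      holds T (\<lambda>_. undefined) (state_val T A (rev w)) (start A)"
    unfolding w' rev_map
    by (rule holds_iso[OF closed inj hom rel _ start(1)])
      (use state_val_iso[OF A closed inj hom rel wD] start(2) in auto)
  then show ?thesis using w(1,2) unfolding lang_eq_holds[OF T A] by blast
qed

theorem theorem7p7:
  fixes V :: "('f, 'r) vocab" and T :: "('f, 'r, 'a) struct" and \<Sigma> :: "'s set"
  assumes "is_struct V T" and "finite \<Sigma>"
  shows "(\<forall>L L'. PAL V T \<Sigma> L \<and> PAL V T \<Sigma> L' \<longrightarrow> PAL V T \<Sigma> (L \<inter> L'))
       \<and> (\<forall>L. PAL V T \<Sigma> L \<longrightarrow> PAL V T \<Sigma> (words \<Sigma> T - L))
       \<and> (\<forall>L L'. monadic_PAL V T \<Sigma> L \<and> monadic_PAL V T \<Sigma> L' \<longrightarrow> monadic_PAL V T \<Sigma> (L \<inter> L'))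
       \<and> (\<forall>L. monadic_PAL V T \<Sigma> L \<longrightarrow> monadic_PAL V T \<Sigma> (words \<Sigma> T - L))
       \<and> (\<forall>L. PAL V T \<Sigma> L \<longrightarrow>
            (\<forall>w\<in>L. \<forall>w'\<in>words \<Sigma> T. word_equiv V T w w' \<longrightarrow> w' \<in> L))"
proof (intro conjI)
  show "\<forall>L L'. PAL V T \<Sigma> L \<and> PAL V T \<Sigma> L' \<longrightarrow> PAL V T \<Sigma> (L \<inter> L')"
    unfolding PAL_def using is_PA_inter_pa lang_inter_pa[OF assms(1)] by metis
  show "\<forall>L. PAL V T \<Sigma> L \<longrightarrow> PAL V T \<Sigma> (words \<Sigma> T - L)"
    unfolding PAL_def using is_PA_compl_pa lang_compl_pa[OF assms(1)] by metis
  have "monadic (inter_pa A B)" if "is_PA V \<Sigma> A" "is_PA V \<Sigma> B" "monadic A" "monadic B"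
    for A B :: "('f, 'r, nat, 's) pa"
    using that by (simp add: monadic_def pa_arity_inter_pa)
  then show "\<forall>L L'. monadic_PAL V T \<Sigma> L \<and> monadic_PAL V T \<Sigma> L' \<longrightarrow> monadic_PAL V T \<Sigma> (L \<inter> L')"
    unfolding monadic_PAL_def using is_PA_inter_pa lang_inter_pa[OF assms(1)] by metis
  show "\<forall>L. monadic_PAL V T \<Sigma> L \<longrightarrow> monadic_PAL V T \<Sigma> (words \<Sigma> T - L)"
    unfolding monadic_PAL_def using is_PA_compl_pa lang_compl_pa[OF assms(1)] monadic_compl_pa
    by metis
  show "\<forall>L. PAL V T \<Sigma> L \<longrightarrow> (\<forall>w\<in>L. \<forall>w'\<in>words \<Sigma> T. word_equiv V T w w' \<longrightarrow> w' \<in> L)"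
    unfolding PAL_def using lang_word_equiv[OF assms(1)] by blast
qed

end
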